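(* Let $A$ and $C$ be (discrete) abelian groups. Then $Pext(C,A)\subseteq Ext_{t}(C,A)$.
   Context: All groups are discrete abelian groups. For a group $G$, $tG$ denotes its maximal torsion subgroup. $Ext(C,A)$ is the group of equivalence classes of extensions $0\to A\stackrel{\phi}{\to} B\stackrel{\psi}{\to} C\to 0$ (short exact sequences). A subgroup $H$ of a group $B$ is pure if $nH=H\cap nB$ for all positive integers $n$; the extension is pure if $\phi(A)$ is pure in $B$, and $Pext(C,A)$ is the subgroup of $Ext(C,A)$ of elements represented by pure extensions. The extension is a t-extension if the sequence of restricted maps $0\to tA\stackrel{\phi}{\to} tB\stackrel{\psi}{\to} tC\to 0$ is exact, and $Ext_t(C,A)$ is the set of elements of $Ext(C,A)$ represented by t-extensions. *)

theory Defs
  imports "HOL-Algebra.Exact_Sequence"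
begin

text \<open>Abelian groups are the \<open>comm_group\<close>s of HOL-Algebra, hence written multiplicatively:
  the multiple \<open>nx\<close> of the usual additive notation is the power \<open>x [^] n\<close>.\<close>

definition torsion_part :: "'g monoid \<Rightarrow> 'g set" where
  "torsion_part G = {x \<in> carrier G. \<exists>n::nat. n > 0 \<and> x [^]\<^bsub>G\<^esub> n = \<one>\<^bsub>G\<^esub>}"

definition tor :: "'g monoid \<Rightarrow> 'g monoid" where
  "tor G = G\<lparr>carrier := torsion_part G\<rparr>"

lemma subgroup_torsion_part:
  fixes G :: "'g monoid"
  assumes "comm_group G"
  shows "subgroup (torsion_part G) G"
proof -
  interpret comm_group G by fact
  show ?thesis
  proof (rule subgroupI)
    show "torsion_part G \<subseteq> carrier G"
      by (auto simp: torsion_part_def)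
    have "\<one>\<^bsub>G\<^esub> [^]\<^bsub>G\<^esub> (1::nat) = \<one>\<^bsub>G\<^esub>" by simp
    then have "\<one>\<^bsub>G\<^esub> \<in> torsion_part G"
      unfolding torsion_part_def by blast
    then show "torsion_part G \<noteq> {}" by blast
  next
    fix a assume "a \<in> torsion_part G"
    then obtain n :: nat where n: "a \<in> carrier G" "n > 0" "a [^]\<^bsub>G\<^esub> n = \<one>\<^bsub>G\<^esub>"
      by (auto simp: torsion_part_def)
    then have "inv\<^bsub>G\<^esub> a [^]\<^bsub>G\<^esub> n = \<one>\<^bsub>G\<^esub>" by (simp add: nat_pow_inv)
    with n show "inv\<^bsub>G\<^esub> a \<in> torsion_part G"
      unfolding torsion_part_def by blast
  next
    fix a b assume "a \<in> torsion_part G" "b \<in> torsion_part G"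
    then obtain m n :: nat where
      a: "a \<in> carrier G" "m > 0" "a [^]\<^bsub>G\<^esub> m = \<one>\<^bsub>G\<^esub>" and
      b: "b \<in> carrier G" "n > 0" "b [^]\<^bsub>G\<^esub> n = \<one>\<^bsub>G\<^esub>"
      by (auto simp: torsion_part_def)
    have "a [^]\<^bsub>G\<^esub> (m * n) = \<one>\<^bsub>G\<^esub>" using a by (simp add: nat_pow_pow[symmetric])
    moreover have "b [^]\<^bsub>G\<^esub> (m * n) = \<one>\<^bsub>G\<^esub>"
      using b by (simp add: nat_pow_pow[symmetric] mult.commute[of m n])
    ultimately have "(a \<otimes>\<^bsub>G\<^esub> b) [^]\<^bsub>G\<^esub> (m * n) = \<one>\<^bsub>G\<^esub>"
      using a b by (simp add: nat_pow_distrib)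
    moreover have "m * n > 0" using a b by simp
    ultimately show "a \<otimes>\<^bsub>G\<^esub> b \<in> torsion_part G"
      using a b unfolding torsion_part_def by blast
  qed
qed

text \<open>\<open>tor G\<close> is the largest subgroup of \<open>G\<close> that is a torsion group.\<close>

lemma torsion_part_greatest:
  fixes G :: "'g monoid"
  assumes "subgroup H G" "torsion_part (G\<lparr>carrier := H\<rparr>) = H"
  shows "H \<subseteq> torsion_part G"
proof
  fix x assume "x \<in> H"
  then have "x \<in> torsion_part (G\<lparr>carrier := H\<rparr>)" using assms(2) by simp
  then obtain n :: nat where "n > 0" "x [^]\<^bsub>G\<^esub> n = \<one>\<^bsub>G\<^esub>"
    by (auto simp: torsion_part_def nat_pow_def)
  then show "x \<in> torsion_part G"
    using \<open>x \<in> H\<close> subgroup.subset[OF assms(1)] by (auto simp: torsion_part_def)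
qed

lemma torsion_part_tor: "torsion_part (tor G) = torsion_part G"
  by (auto simp: torsion_part_def tor_def nat_pow_def)


text \<open>The library's \<open>short_exact_sequence\<close> forces the three groups to have the same
  element type (and lists them from right to left); this is the same notion for arbitrary types.\<close>

definition short_exact ::
  "'a monoid \<Rightarrow> 'b monoid \<Rightarrow> 'c monoid \<Rightarrow> ('a \<Rightarrow> 'b) \<Rightarrow> ('b \<Rightarrow> 'c) \<Rightarrow> bool" where
  "short_exact A B C \<phi> \<psi> \<longleftrightarrow>
     group A \<and> group B \<and> group C \<and>
     \<phi> \<in> mon A B \<and> \<psi> \<in> epi B C \<and> kernel B C \<psi> = \<phi> ` carrier A"

lemma short_exact_eq_library:
  "short_exact A B C \<phi> \<psi> \<longleftrightarrow> short_exact_sequence C B A \<psi> \<phi>"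
  by (auto simp: short_exact_def short_exact_sequence_iff group_hom_def group_hom_axioms_def
      mon_def epi_def)

text \<open>An extension \<open>(B, \<phi>, \<psi>)\<close> of \<open>A\<close> by \<open>C\<close>, with the elements of \<open>B\<close> taken from the type \<open>'b\<close>.\<close>

type_synonym ('a, 'b, 'c) extn = "'b monoid \<times> ('a \<Rightarrow> 'b) \<times> ('b \<Rightarrow> 'c)"

definition extensions :: "'c monoid \<Rightarrow> 'a monoid \<Rightarrow> ('a, 'b, 'c) extn set" where
  "extensions C A = {(B, \<phi>, \<psi>). comm_group B \<and> short_exact A B C \<phi> \<psi>}"

definition equivalent_extn ::
  "'c monoid \<Rightarrow> 'a monoid \<Rightarrow> ('a, 'b, 'c) extn \<Rightarrow> ('a, 'd, 'c) extn \<Rightarrow> bool" where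
  "equivalent_extn C A = (\<lambda>(B, \<phi>, \<psi>) (B', \<phi>', \<psi>').
     \<exists>h \<in> iso B B'. (\<forall>a \<in> carrier A. h (\<phi> a) = \<phi>' a) \<and> (\<forall>b \<in> carrier B. \<psi>' (h b) = \<psi> b))"

definition extn_rel :: "'c monoid \<Rightarrow> 'a monoid \<Rightarrow> (('a, 'b, 'c) extn \<times> ('a, 'b, 'c) extn) set" where
  "extn_rel C A = {(E, E'). E \<in> extensions C A \<and> E' \<in> extensions C A \<and> equivalent_extn C A E E'}"

text \<open>HOL has no type of all groups, so the type \<open>'b\<close> of the elements of the middle groups is a
  parameter. It does not matter as soon as \<open>'b\<close> is large enough, e.g. \<open>'b = 'a \<times> 'c\<close>: see
  \<open>extension_equivalent_prod\<close> below.\<close>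

definition Ext :: "'c monoid \<Rightarrow> 'a monoid \<Rightarrow> ('a, 'b, 'c) extn set set" where
  "Ext C A = extensions C A // extn_rel C A"

definition pure_subgroup :: "'b set \<Rightarrow> 'b monoid \<Rightarrow> bool" where
  "pure_subgroup H B \<longleftrightarrow> subgroup H B \<and>
     (\<forall>n::nat. n > 0 \<longrightarrow>
        (\<lambda>x. x [^]\<^bsub>B\<^esub> n) ` H = H \<inter> (\<lambda>x. x [^]\<^bsub>B\<^esub> n) ` carrier B)"

definition pure_extension :: "'a monoid \<Rightarrow> ('a, 'b, 'c) extn \<Rightarrow> bool" where
  "pure_extension A = (\<lambda>(B, \<phi>, \<psi>). pure_subgroup (\<phi> ` carrier A) B)"

definition t_extension :: "'c monoid \<Rightarrow> 'a monoid \<Rightarrow> ('a, 'b, 'c) extn \<Rightarrow> bool" where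
  "t_extension C A = (\<lambda>(B, \<phi>, \<psi>). short_exact (tor A) (tor B) (tor C) \<phi> \<psi>)"

definition Pext :: "'c monoid \<Rightarrow> 'a monoid \<Rightarrow> ('a, 'b, 'c) extn set set" where
  "Pext C A = {K \<in> Ext C A. \<exists>E \<in> K. pure_extension A E}"

definition Ext_t :: "'c monoid \<Rightarrow> 'a monoid \<Rightarrow> ('a, 'b, 'c) extn set set" where
  "Ext_t C A = {K \<in> Ext C A. \<exists>E \<in> K. t_extension C A E}"

lemma equiv_extn_rel:
  fixes A :: "'a monoid" and C :: "'c monoid"
  shows "equiv (extensions C A) (extn_rel C A :: (('a, 'b, 'c) extn \<times> _) set)"
proof (rule equivI)
  let ?R = "extn_rel C A :: (('a, 'b, 'c) extn \<times> _) set"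
  show "?R \<subseteq> extensions C A \<times> extensions C A"
    by (auto simp: extn_rel_def)
  show "refl_on (extensions C A) ?R"
  proof (rule refl_onI)
    fix E :: "('a, 'b, 'c) extn" assume "E \<in> extensions C A"
    moreover obtain B \<phi> \<psi> where "E = (B, \<phi>, \<psi>)" by (cases E)
    moreover have "(\<lambda>x. x) \<in> iso B B" by (auto simp: iso_def hom_def bij_betw_def)
    ultimately show "(E, E) \<in> ?R"
      unfolding extn_rel_def equivalent_extn_def by force
  qed
  show "sym ?R"
  proof (rule symI)
    fix E E' :: "('a, 'b, 'c) extn" assume EE: "(E, E') \<in> ?R"
    obtain B \<phi> \<psi> where E: "E = (B, \<phi>, \<psi>)" by (cases E)
    obtain B' \<phi>' \<psi>' where E': "E' = (B', \<phi>', \<psi>')" by (cases E')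
    from EE E E' have ext: "E \<in> extensions C A" "E' \<in> extensions C A"
      by (auto simp: extn_rel_def)
    from EE E E' obtain h where h: "h \<in> iso B B'"
      "\<And>a. a \<in> carrier A \<Longrightarrow> h (\<phi> a) = \<phi>' a" "\<And>b. b \<in> carrier B \<Longrightarrow> \<psi>' (h b) = \<psi> b"
      by (auto simp: extn_rel_def equivalent_extn_def)
    let ?g = "inv_into (carrier B) h"
    have B: "group B" and \<phi>: "\<And>a. a \<in> carrier A \<Longrightarrow> \<phi> a \<in> carrier B"
      using ext E by (auto simp: extensions_def short_exact_def mon_def hom_def)
    have bij: "bij_betw h (carrier B) (carrier B')" using h by (auto simp: iso_def)
    have "?g \<in> iso B' B" by (rule group.iso_set_sym[OF B h(1)])
    moreover have "?g (\<phi>' a) = \<phi> a" if "a \<in> carrier A" for a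
      using h(2)[OF that] \<phi>[OF that] bij by (metis bij_betw_inv_into_left)
    moreover have "\<psi> (?g b) = \<psi>' b" if "b \<in> carrier B'" for b
    proof -
      have "?g b \<in> carrier B" "h (?g b) = b"
        using that bij by (auto simp: bij_betw_def inv_into_into f_inv_into_f)
      then show ?thesis using h(3)[of "?g b"] by simp
    qed
    ultimately show "(E', E) \<in> ?R"
      using ext E E' by (auto simp: extn_rel_def equivalent_extn_def intro!: bexI[of _ ?g])
  qed
  show "trans ?R"
  proof (rule transI)
    fix E E' E'' :: "('a, 'b, 'c) extn" assume EE: "(E, E') \<in> ?R" "(E', E'') \<in> ?R"
    obtain B \<phi> \<psi> where E: "E = (B, \<phi>, \<psi>)" by (cases E)
    obtain B' \<phi>' \<psi>' where E': "E' = (B', \<phi>', \<psi>')" by (cases E')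
    obtain B'' \<phi>'' \<psi>'' where E'': "E'' = (B'', \<phi>'', \<psi>'')" by (cases E'')
    from EE E E' obtain h where h: "h \<in> iso B B'"
      "\<And>a. a \<in> carrier A \<Longrightarrow> h (\<phi> a) = \<phi>' a" "\<And>b. b \<in> carrier B \<Longrightarrow> \<psi>' (h b) = \<psi> b"
      by (auto simp: extn_rel_def equivalent_extn_def)
    from EE E' E'' obtain k where k: "k \<in> iso B' B''"
      "\<And>a. a \<in> carrier A \<Longrightarrow> k (\<phi>' a) = \<phi>'' a" "\<And>b. b \<in> carrier B' \<Longrightarrow> \<psi>'' (k b) = \<psi>' b"
      by (auto simp: extn_rel_def equivalent_extn_def)
    have "k \<circ> h \<in> iso B B''" by (rule iso_set_trans[OF h(1) k(1)])
    moreover have "h b \<in> carrier B'" if "b \<in> carrier B" for b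
      using that h(1) by (auto simp: iso_def hom_def)
    ultimately show "(E, E'') \<in> ?R"
      using EE E E'' h k
      by (auto simp: extn_rel_def equivalent_extn_def intro!: bexI[of _ "k \<circ> h"])
  qed
qed

text \<open>Every extension, whatever the type of its elements, is equivalent to one whose elements
  are pairs in \<open>'a \<times> 'c\<close>.\<close>

lemma extension_equivalent_prod:
  fixes A :: "'a monoid" and C :: "'c monoid" and E :: "('a, 'b, 'c) extn"
  assumes "E \<in> extensions C A"
  shows "\<exists>E' :: ('a, 'a \<times> 'c, 'c) extn. E' \<in> extensions C A \<and> equivalent_extn C A E E'"
proof -
  obtain B \<phi> \<psi> where E: "E = (B, \<phi>, \<psi>)" by (cases E)
  from assms E have cB: "comm_group B" and se: "short_exact A B C \<phi> \<psi>"
    by (auto simp: extensions_def)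
  interpret B: comm_group B by fact
  from se have gA: "group A" and gC: "group C"
    and \<phi>h: "\<phi> \<in> hom A B" and \<phi>i: "inj_on \<phi> (carrier A)"
    and \<psi>h: "\<psi> \<in> hom B C" and \<psi>s: "\<psi> ` carrier B = carrier C"
    and ker: "kernel B C \<psi> = \<phi> ` carrier A"
    by (auto simp: short_exact_def mon_def epi_def)
  interpret \<psi>: group_hom B C \<psi>
    using B.group_axioms gC \<psi>h by (simp add: group_hom_def group_hom_axioms_def)
  define s where "s c = inv_into (carrier B) \<psi> c" for c
  have s: "s (\<psi> b) \<in> carrier B" "\<psi> (s (\<psi> b)) = \<psi> b" if "b \<in> carrier B" for b
    using that by (auto simp: s_def inv_into_into f_inv_into_f)
  define d where "d b = b \<otimes>\<^bsub>B\<^esub> inv\<^bsub>B\<^esub> (s (\<psi> b))" for b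
  have d: "d b \<in> \<phi> ` carrier A" if "b \<in> carrier B" for b
  proof -
    have "d b \<in> kernel B C \<psi>"
      using that s[OF that] by (simp add: kernel_def d_def)
    then show ?thesis using ker by simp
  qed
  define f where "f b = (inv_into (carrier A) \<phi> (d b), \<psi> b)" for b
  have inj: "inj_on f (carrier B)"
  proof (rule inj_onI)
    fix x y assume xy: "x \<in> carrier B" "y \<in> carrier B" "f x = f y"
    then have p: "\<psi> x = \<psi> y" and "d x = d y"
      using d[of x] d[of y] by (auto simp: f_def intro: inv_into_injective)
    then show "x = y" using xy s[of y] by (simp add: d_def)
  qed
  define g where "g = inv_into (carrier B) f"
  have gf: "g (f b) = b" if "b \<in> carrier B" for b
    using inj that by (simp add: g_def)
  define B' where "B' = \<lparr>carrier = f ` carrier B,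
    mult = (\<lambda>x y. f (g x \<otimes>\<^bsub>B\<^esub> g y)), one = f \<one>\<^bsub>B\<^esub>\<rparr>"
  have fi: "f \<in> iso B B'"
    using inj by (auto simp: iso_def hom_def bij_betw_def B'_def gf)
  have cB': "comm_group B'"
  proof (rule comm_groupI)
    fix x assume "x \<in> carrier B'"
    then obtain b where b: "b \<in> carrier B" "x = f b" by (auto simp: B'_def)
    then have "f (inv\<^bsub>B\<^esub> b) \<in> carrier B'" "f (inv\<^bsub>B\<^esub> b) \<otimes>\<^bsub>B'\<^esub> x = \<one>\<^bsub>B'\<^esub>"
      by (auto simp: B'_def gf)
    then show "\<exists>y\<in>carrier B'. y \<otimes>\<^bsub>B'\<^esub> x = \<one>\<^bsub>B'\<^esub>" by blast
  qed (auto simp: B'_def gf B.m_ac)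
  define \<phi>' where "\<phi>' = f \<circ> \<phi>"
  define \<psi>' where "\<psi>' = \<psi> \<circ> g"
  have \<phi>c: "\<phi> a \<in> carrier B" if "a \<in> carrier A" for a
    using that \<phi>h by (auto simp: hom_def)
  have "\<phi>' \<in> mon A B'"
    using \<phi>h \<phi>i \<phi>c inj
    by (auto simp: mon_def hom_def \<phi>'_def B'_def gf inj_on_def)
  moreover have "\<psi>' \<in> epi B' C"
    using \<psi>h \<psi>s by (auto simp: epi_def hom_def \<psi>'_def B'_def gf image_comp image_iff)
  moreover have "kernel B' C \<psi>' = \<phi>' ` carrier A"
  proof -
    have "kernel B' C \<psi>' = f ` kernel B C \<psi>"
      by (auto simp: kernel_def \<psi>'_def B'_def gf)
    then show ?thesis by (simp add: ker \<phi>'_def image_comp)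
  qed
  ultimately have "short_exact A B' C \<phi>' \<psi>'"
    using cB' gA gC by (simp add: short_exact_def comm_group_def)
  then have "(B', \<phi>', \<psi>') \<in> extensions C A"
    using cB' by (simp add: extensions_def)
  moreover have "equivalent_extn C A E (B', \<phi>', \<psi>')"
    unfolding equivalent_extn_def E
    by (auto intro!: bexI[OF _ fi] simp: \<phi>'_def \<psi>'_def gf)
  ultimately show ?thesis by blast
qed

end

theory Submission
  imports Defs
begin

text \<open>Let \<open>0 \<rightarrow> A \<rightarrow> B \<rightarrow> C \<rightarrow> 0\<close> be an extension with maps \<open>\<phi>\<close> and \<open>\<psi>\<close>. Restriction to the torsion
  parts always gives a left exact sequence: a homomorphism preserves torsion, and the injective map
  \<open>\<phi>\<close> also reflects it, so that the torsion elements of \<open>kernel B C \<psi> = \<phi> ` carrier A\<close> all come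
  from \<open>tor A\<close>. Purity is what makes \<open>tor B \<rightarrow> tor C\<close> surjective. In additive notation, if \<open>nc = 0\<close>
  and \<open>b\<close> is a preimage of \<open>c\<close>, then \<open>nb\<close> lies in \<open>\<phi> ` carrier A\<close>, hence by purity \<open>nb = nh\<close> for
  some \<open>h\<close> in \<open>\<phi> ` carrier A\<close>, and \<open>b - h\<close> is a preimage of \<open>c\<close> killed by \<open>n\<close>
  (\<open>torsion_lifts_along_pure_kernel\<close>). So a pure extension is itself a t-extension, and a class of
  extensions with a pure representative has a representative that is a t-extension.\<close>

lemma carrier_tor [simp]: "carrier (tor G) = torsion_part G"
  and mult_tor [simp]: "x \<otimes>\<^bsub>tor G\<^esub> y = x \<otimes>\<^bsub>G\<^esub> y"
  and one_tor [simp]: "\<one>\<^bsub>tor G\<^esub> = \<one>\<^bsub>G\<^esub>"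
  by (simp_all add: tor_def)

lemma torsion_part_subset: "torsion_part G \<subseteq> carrier G"
  by (auto simp: torsion_part_def)

lemma group_tor:
  assumes "comm_group G"
  shows "group (tor G)"
proof -
  interpret comm_group G by fact
  show ?thesis
    using subgroup.subgroup_is_group[OF subgroup_torsion_part[OF assms]] is_group
    by (simp add: tor_def)
qed

lemma hom_torsion_part:
  fixes G :: "'g monoid" and H :: "'h monoid"
  assumes "group_hom G H h" and "x \<in> torsion_part G"
  shows "h x \<in> torsion_part H"
proof -
  interpret group_hom G H h by fact
  show ?thesis
    using assms(2) by (auto simp: torsion_part_def hom_nat_pow[symmetric])
qed

lemma hom_tor:
  fixes G :: "'g monoid" and H :: "'h monoid"
  assumes "group_hom G H h"
  shows "h \<in> hom (tor G) (tor H)"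
proof -
  interpret group_hom G H h by fact
  show ?thesis
    using torsion_part_subset[of G] by (auto intro!: homI simp: subset_iff hom_torsion_part[OF assms])
qed

lemma torsion_part_if_inj:
  fixes G :: "'g monoid" and H :: "'h monoid"
  assumes "group_hom G H h" and "inj_on h (carrier G)"
    and "x \<in> carrier G" and "h x \<in> torsion_part H"
  shows "x \<in> torsion_part G"
proof -
  interpret group_hom G H h by fact
  obtain n :: nat where "n > 0" and "h x [^]\<^bsub>H\<^esub> n = \<one>\<^bsub>H\<^esub>"
    using assms(4) by (auto simp: torsion_part_def)
  then have "h (x [^]\<^bsub>G\<^esub> n) = h \<one>\<^bsub>G\<^esub>"
    using assms(3) by (simp add: hom_nat_pow)
  then have "x [^]\<^bsub>G\<^esub> n = \<one>\<^bsub>G\<^esub>"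
    using inj_onD[OF assms(2)] assms(3) by simp
  then show ?thesis
    using \<open>n > 0\<close> assms(3) by (auto simp: torsion_part_def)
qed

text \<open>The only use of purity. Commutativity of \<open>B\<close> enters through \<open>n(b - h) = nb - nh\<close>.\<close>

lemma torsion_lifts_along_pure_kernel:
  assumes "comm_group B" and "group C"
    and "\<psi> \<in> hom B C" and surj: "\<psi> ` carrier B = carrier C"
    and pure: "pure_subgroup (kernel B C \<psi>) B"
  shows "torsion_part C \<subseteq> \<psi> ` torsion_part B"
proof
  interpret B: comm_group B by fact
  interpret \<psi>: group_hom B C \<psi>
    using assms by (simp add: group_hom_def group_hom_axioms_def B.is_group)
  fix c assume "c \<in> torsion_part C"
  then obtain n :: nat where c: "c \<in> carrier C" and n: "n > 0" "c [^]\<^bsub>C\<^esub> n = \<one>\<^bsub>C\<^esub>"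
    by (auto simp: torsion_part_def)
  obtain b where b: "b \<in> carrier B" "\<psi> b = c"
    using c surj by (metis imageE)
  have "b [^]\<^bsub>B\<^esub> n \<in> kernel B C \<psi>"
    using b n by (simp add: kernel_def \<psi>.hom_nat_pow)
  then have "b [^]\<^bsub>B\<^esub> n \<in> (\<lambda>x. x [^]\<^bsub>B\<^esub> n) ` kernel B C \<psi>"
    using pure n(1) b(1) by (auto simp: pure_subgroup_def)
  then obtain h where h: "h \<in> carrier B" "\<psi> h = \<one>\<^bsub>C\<^esub>" "b [^]\<^bsub>B\<^esub> n = h [^]\<^bsub>B\<^esub> n"
    by (auto simp: kernel_def)
  have "(b \<otimes>\<^bsub>B\<^esub> inv\<^bsub>B\<^esub> h) [^]\<^bsub>B\<^esub> n = \<one>\<^bsub>B\<^esub>"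
    using b(1) h by (simp add: B.nat_pow_distrib B.nat_pow_inv)
  then have "b \<otimes>\<^bsub>B\<^esub> inv\<^bsub>B\<^esub> h \<in> torsion_part B"
    using n(1) b(1) h(1) by (auto simp: torsion_part_def)
  moreover have "\<psi> (b \<otimes>\<^bsub>B\<^esub> inv\<^bsub>B\<^esub> h) = c"
    using b h c by simp
  ultimately show "c \<in> \<psi> ` torsion_part B" by force
qed

lemma pure_extension_imp_t_extension:
  assumes "comm_group A" and "comm_group C"
    and "E \<in> extensions C A" and "pure_extension A E"
  shows "t_extension C A E"
proof -
  obtain B \<phi> \<psi> where E: "E = (B, \<phi>, \<psi>)" by (cases E)
  with assms(3) have "comm_group B" and se: "short_exact A B C \<phi> \<psi>"
    by (auto simp: extensions_def)
  from se have inj: "inj_on \<phi> (carrier A)" and surj: "\<psi> ` carrier B = carrier C"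
    and ker: "kernel B C \<psi> = \<phi> ` carrier A"
    by (auto simp: short_exact_def mon_def epi_def)
  interpret \<phi>: group_hom A B \<phi>
    using se by (simp add: short_exact_def mon_def group_hom_def group_hom_axioms_def)
  interpret \<psi>: group_hom B C \<psi>
    using se by (simp add: short_exact_def epi_def group_hom_def group_hom_axioms_def)
  have "\<phi> \<in> mon (tor A) (tor B)"
    using hom_tor[OF \<phi>.group_hom_axioms] inj_on_subset[OF inj torsion_part_subset] by (simp add: mon_def)
  moreover have "\<psi> \<in> epi (tor B) (tor C)"
  proof -
    have "pure_subgroup (kernel B C \<psi>) B"
      using assms(4) by (simp add: E pure_extension_def ker)
    then have "torsion_part C \<subseteq> \<psi> ` torsion_part B"
      using torsion_lifts_along_pure_kernel \<open>comm_group B\<close> \<psi>.H.is_group \<psi>.homh surj by blast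
    then show ?thesis
      using hom_tor[OF \<psi>.group_hom_axioms] by (auto simp: epi_def hom_torsion_part[OF \<psi>.group_hom_axioms])
  qed
  moreover have "kernel (tor B) (tor C) \<psi> = \<phi> ` carrier (tor A)"
  proof -
    have "kernel (tor B) (tor C) \<psi> = torsion_part B \<inter> \<phi> ` carrier A"
      using torsion_part_subset[of B] by (auto simp: kernel_def simp flip: ker)
    also have "\<dots> = \<phi> ` torsion_part A"
      using torsion_part_subset[of A] hom_torsion_part[OF \<phi>.group_hom_axioms] torsion_part_if_inj[OF \<phi>.group_hom_axioms inj]
      by blast
    finally show ?thesis by simp
  qed
  ultimately show ?thesis
    using assms(1,2) \<open>comm_group B\<close>
    by (simp add: E t_extension_def short_exact_def group_tor)
qed

theorem lemma1p7:
  fixes A :: "'a monoid" and C :: "'c monoid"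
  assumes "comm_group A" and "comm_group C"
  shows "(Pext C A :: ('a, 'b, 'c) extn set set) \<subseteq> Ext_t C A"
proof
  fix K :: "('a, 'b, 'c) extn set" assume "K \<in> Pext C A"
  then obtain E where K: "K \<in> Ext C A" and E: "E \<in> K" "pure_extension A E"
    by (auto simp: Pext_def)
  have "E \<in> extensions C A"
    using in_quotient_imp_subset[OF equiv_extn_rel] K E(1) unfolding Ext_def by blast
  then have "t_extension C A E"
    using pure_extension_imp_t_extension[OF assms] E(2) by blast
  then show "K \<in> Ext_t C A"
    using K E(1) by (auto simp: Ext_t_def)
qed

end
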